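(* For every $k$-dimensional linear subspace $E\subset\mathbb{R}^n$ ($1\le k\le n$) and every $r>0$, $$\gamma_E(E\cap rB_\infty^n)\le\gamma_k\left(r\sqrt{\frac nk}\,B_\infty^k\right).$$
   Context: $B_\infty^n=[-1,1]^n$. $\gamma_k$ denotes the standard Gaussian probability measure on $\mathbb{R}^k$, and $\gamma_E$ the standard Gaussian probability measure on the subspace $E$ (with the Euclidean structure inherited from $\mathbb{R}^n$). *)

theory Defs
  imports "HOL-Probability.Probability"
begin

definition cube_ball :: "(real ^ 'n) set" where
  "cube_ball = {x. \<forall>i. x $ i \<in> {-1..1}}"

definition std_gaussian :: "'a::euclidean_space measure" where
  "std_gaussian = density lborel
     (\<lambda>x. ennreal ((2 * pi) powr - (real DIM('a) / 2) * exp (- (norm x)\<^sup>2 / 2)))"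

definition orthonormal_basis_of :: "'a::euclidean_space set \<Rightarrow> 'a set \<Rightarrow> bool" where
  "orthonormal_basis_of E B \<longleftrightarrow>
     B \<subseteq> E \<and> pairwise orthogonal B \<and> (\<forall>b\<in>B. norm b = 1) \<and> span B = E"

definition frame_lborel :: "'a::euclidean_space set \<Rightarrow> 'a measure" where
  "frame_lborel B = distr (\<Pi>\<^sub>M b\<in>B. lborel) borel (\<lambda>f. \<Sum>b\<in>B. f b *\<^sub>R b)"

text \<open>
  Lebesgue measure on \<open>E\<close>, built from an orthonormal basis of \<open>E\<close> exactly as \<^const>\<open>lborel\<close>
  is built from \<^const>\<open>Basis\<close>. It is a measure on the Borel sets of the ambient space that is
  concentrated on \<open>E\<close>. Lemma \<open>subspace_lborel_eq\<close> below shows that the choice of the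
  basis is immaterial.
\<close>

definition subspace_lborel :: "'a::euclidean_space set \<Rightarrow> 'a measure" where
  "subspace_lborel E = frame_lborel (SOME B. orthonormal_basis_of E B)"

definition subspace_gaussian :: "'a::euclidean_space set \<Rightarrow> 'a measure" where
  "subspace_gaussian E = density (subspace_lborel E)
     (\<lambda>x. ennreal ((2 * pi) powr - (real (dim E) / 2) * exp (- (norm x)\<^sup>2 / 2)))"

lemma orthonormal_basis_of_exists:
  assumes "subspace E"
  shows "\<exists>B. orthonormal_basis_of E B"
  using orthonormal_basis_subspace[OF assms] unfolding orthonormal_basis_of_def by metis

lemma orthonormal_basis_of_finite_card:
  assumes "orthonormal_basis_of E B"
  shows "finite B" "card B = dim E"
proof -
  have "independent B"
    using assms by (intro pairwise_orthogonal_independent) (auto simp: orthonormal_basis_of_def)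
  moreover have "span B = span E"
    using assms by (metis orthonormal_basis_of_def span_span)
  ultimately show "finite B" "card B = dim E"
    by (simp_all add: independent_imp_finite dim_eq_card)
qed

lemma orthonormal_norm_sum:
  assumes "orthonormal_basis_of E B"
  shows "(norm (\<Sum>b\<in>B. f b *\<^sub>R b))\<^sup>2 = (\<Sum>b\<in>B. (f b)\<^sup>2)"
proof -
  have "(norm (\<Sum>b\<in>B. f b *\<^sub>R b))\<^sup>2 = (\<Sum>b\<in>B. (norm (f b *\<^sub>R b))\<^sup>2)"
    using assms orthonormal_basis_of_finite_card(1)[OF assms]
    by (intro norm_sum_Pythagorean)
       (auto simp: orthonormal_basis_of_def pairwise_def orthogonal_def)
  also have "\<dots> = (\<Sum>b\<in>B. (f b)\<^sup>2)"
    using assms by (intro sum.cong) (auto simp: orthonormal_basis_of_def)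
  finally show ?thesis .
qed

lemma frame_sum_measurable [measurable]:
  "(\<lambda>f. \<Sum>b\<in>B. f b *\<^sub>R b) \<in> (\<Pi>\<^sub>M b\<in>B. (lborel :: real measure)) \<rightarrow>\<^sub>M (borel :: 'a::euclidean_space measure)"
  by measurable

lemma sets_frame_lborel [simp, measurable_cong]: "sets (frame_lborel B) = sets borel"
  and space_frame_lborel [simp]: "space (frame_lborel B) = UNIV"
  by (simp_all add: frame_lborel_def)

lemma AE_frame_lborel:
  assumes "orthonormal_basis_of E B"
  shows "AE x in frame_lborel B. x \<in> E"
proof -
  have "closed E" "subspace E"
    using assms by (auto simp: orthonormal_basis_of_def closed_subspace)
  moreover have "(\<Sum>b\<in>B. f b *\<^sub>R b) \<in> E" for f
    using assms \<open>subspace E\<close> by (intro subspace_sum subspace_scale) (auto simp: orthonormal_basis_of_def)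
  ultimately show ?thesis
    unfolding frame_lborel_def by (subst AE_distr_iff) auto
qed

lemma emeasure_frame_cball:
  assumes B: "orthonormal_basis_of E B" and r: "0 < r"
  shows "emeasure (frame_lborel B) (cball 0 r) = ennreal (unit_ball_vol (real (dim E)) * r ^ dim E)"
proof -
  have "(\<Sum>b\<in>B. f b *\<^sub>R b) \<in> cball 0 r \<longleftrightarrow> sqrt (\<Sum>b\<in>B. (f b)\<^sup>2) \<le> r" for f
    by (simp flip: orthonormal_norm_sum[OF B])
  then have "(\<lambda>f. \<Sum>b\<in>B. f b *\<^sub>R b) -` cball 0 r = {f. sqrt (\<Sum>b\<in>B. (f b)\<^sup>2) \<le> r}"
    by blast
  then show ?thesis
    using emeasure_cball_aux[of B r] orthonormal_basis_of_finite_card[OF B] r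
    by (simp add: frame_lborel_def emeasure_distr)
qed

lemma sigma_finite_frame_lborel:
  assumes B: "orthonormal_basis_of E B"
  shows "sigma_finite_measure (frame_lborel B)"
proof
  let ?C = "range (\<lambda>n. cball 0 (real (Suc n))) :: 'a set set"
  have "\<exists>n. norm x \<le> real (Suc n)" for x :: 'a
  proof -
    obtain n where "norm x \<le> real n"
      using real_arch_simple by blast
    then show ?thesis
      by (intro exI[of _ n]) simp
  qed
  then have "\<Union> ?C = UNIV"
    by (auto simp del: of_nat_Suc)
  then show "\<exists>A. countable A \<and> A \<subseteq> sets (frame_lborel B) \<and> \<Union> A = space (frame_lborel B) \<and>
      (\<forall>a\<in>A. emeasure (frame_lborel B) a \<noteq> \<infinity>)"
    by (intro exI[of _ ?C]) (auto simp: emeasure_frame_cball[OF B])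
qed

lemma PiM_lborel_translate:
  assumes "finite B"
  shows "distr (\<Pi>\<^sub>M b\<in>B. (lborel :: real measure)) (\<Pi>\<^sub>M b\<in>B. lborel) (\<lambda>f. \<lambda>b\<in>B. c b + f b)
    = (\<Pi>\<^sub>M b\<in>B. lborel)" (is "?D = _")
proof (rule product_sigma_finite.PiM_eqI)
  show "product_sigma_finite (\<lambda>_. lborel :: real measure)"
    by standard
  fix A :: "'a \<Rightarrow> real set"
  assume A: "\<And>i. i \<in> B \<Longrightarrow> A i \<in> sets lborel"
  have *: "(\<lambda>x. c i + x) -` A i \<in> sets lborel"
    "emeasure lborel ((\<lambda>x. c i + x) -` A i) = emeasure lborel (A i)" if "i \<in> B" for i
  proof -
    have A': "A i \<in> sets borel" using A[OF that] by simp
    show "(\<lambda>x. c i + x) -` A i \<in> sets lborel"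
      using measurable_sets[OF _ A', of "\<lambda>x. c i + x" borel] by simp
    have "emeasure (distr lborel borel ((+) (c i))) (A i) = emeasure lborel (A i)"
      by (simp add: lborel_distr_plus)
    then show "emeasure lborel ((\<lambda>x. c i + x) -` A i) = emeasure lborel (A i)"
      using A' by (simp add: emeasure_distr)
  qed
  have "emeasure ?D (Pi\<^sub>E B A) = emeasure (\<Pi>\<^sub>M b\<in>B. lborel) (\<Pi>\<^sub>E i\<in>B. (\<lambda>x. c i + x) -` A i)"
    using A assms by (subst emeasure_distr) (auto simp: space_PiM PiE_iff intro!: arg_cong2[where f=emeasure])
  also have "\<dots> = (\<Prod>i\<in>B. emeasure lborel ((\<lambda>x. c i + x) -` A i))"
    using assms * by (intro product_sigma_finite.emeasure_PiM) (auto intro: product_sigma_finite.intro sigma_finite_lborel)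
  finally show "emeasure ?D (Pi\<^sub>E B A) = (\<Prod>i\<in>B. emeasure lborel (A i))"
    using * by simp
qed (use assms in auto)

lemma frame_lborel_translate:
  assumes B: "orthonormal_basis_of E B" and t: "t \<in> E"
  shows "distr (frame_lborel B) borel ((+) t) = frame_lborel B"
proof -
  note fin = orthonormal_basis_of_finite_card(1)[OF B]
  have "t \<in> range (\<lambda>c. \<Sum>b\<in>B. c b *\<^sub>R b)"
    using t B span_finite[OF fin] by (simp add: orthonormal_basis_of_def)
  then obtain c where c: "t = (\<Sum>b\<in>B. c b *\<^sub>R b)"
    by blast
  have "frame_lborel B = distr (distr (\<Pi>\<^sub>M b\<in>B. lborel) (\<Pi>\<^sub>M b\<in>B. lborel) (\<lambda>f. \<lambda>b\<in>B. c b + f b))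
      borel (\<lambda>f. \<Sum>b\<in>B. f b *\<^sub>R b)"
    by (simp add: PiM_lborel_translate[OF fin] frame_lborel_def)
  also have "\<dots> = distr (\<Pi>\<^sub>M b\<in>B. lborel) borel (\<lambda>f. t + (\<Sum>b\<in>B. f b *\<^sub>R b))"
    by (subst distr_distr) (auto simp: o_def c scaleR_left_distrib sum.distrib)
  also have "\<dots> = distr (frame_lborel B) borel ((+) t)"
    unfolding frame_lborel_def by (subst distr_distr) (auto simp: o_def)
  finally show ?thesis ..
qed

lemma nn_integral_frame_translate:
  assumes "orthonormal_basis_of E B" "t \<in> E" "g \<in> borel_measurable borel"
  shows "(\<integral>\<^sup>+x. g (t + x) \<partial>frame_lborel B) = (\<integral>\<^sup>+x. g x \<partial>frame_lborel B)"
proof -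
  have "(\<integral>\<^sup>+x. g x \<partial>frame_lborel B) = (\<integral>\<^sup>+x. g x \<partial>distr (frame_lborel B) borel ((+) t))"
    by (simp add: frame_lborel_translate[OF assms(1,2)])
  also have "\<dots> = (\<integral>\<^sup>+x. g (t + x) \<partial>frame_lborel B)"
    using assms(3) by (subst nn_integral_distr) auto
  finally show ?thesis ..
qed

text \<open>The uniqueness argument for Haar measure, on the group \<open>E\<close>.\<close>

lemma frame_lborel_haar:
  assumes B: "orthonormal_basis_of E B" and C: "orthonormal_basis_of E C"
    and S [measurable]: "S \<in> sets borel" and T [measurable]: "T \<in> sets borel"
  shows "emeasure (frame_lborel B) S * emeasure (frame_lborel C) T
       = emeasure (frame_lborel C) (uminus -` S) * emeasure (frame_lborel B) T"
proof -
  let ?M = "frame_lborel B" and ?N = "frame_lborel C"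
  interpret M: sigma_finite_measure ?M by (rule sigma_finite_frame_lborel[OF B])
  interpret N: sigma_finite_measure ?N by (rule sigma_finite_frame_lborel[OF C])
  interpret P: pair_sigma_finite ?M ?N ..
  have mS: "uminus -` S \<in> sets borel"
    using measurable_sets[OF borel_measurable_uminus[OF measurable_ident] S] by simp
  have "emeasure ?M S * emeasure ?N T = (\<integral>\<^sup>+x. indicator S x * emeasure ?N T \<partial>?M)"
    by (simp add: nn_integral_multc)
  also have "\<dots> = (\<integral>\<^sup>+x. (\<integral>\<^sup>+y. indicator S x * indicator T (x + y) \<partial>?N) \<partial>?M)"
  proof (rule nn_integral_cong_AE, use AE_frame_lborel[OF B] in eventually_elim)
    case (elim x)
    show ?case
      using nn_integral_frame_translate[OF C elim, of "indicator T"]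
      by (simp add: nn_integral_cmult)
  qed
  also have "\<dots> = (\<integral>\<^sup>+y. (\<integral>\<^sup>+x. indicator S x * indicator T (x + y) \<partial>?M) \<partial>?N)"
    by (intro P.Fubini'[symmetric]) measurable
  also have "\<dots> = (\<integral>\<^sup>+y. (\<integral>\<^sup>+x. indicator S (x - y) * indicator T x \<partial>?M) \<partial>?N)"
  proof (rule nn_integral_cong_AE, use AE_frame_lborel[OF C] in eventually_elim)
    case (elim y)
    show ?case
      using nn_integral_frame_translate[OF B elim, of "\<lambda>x. indicator S (x - y) * indicator T x"]
      by (simp add: add.commute)
  qed
  also have "\<dots> = (\<integral>\<^sup>+x. (\<integral>\<^sup>+y. indicator S (x - y) * indicator T x \<partial>?N) \<partial>?M)"
    by (intro P.Fubini') measurable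
  also have "\<dots> = (\<integral>\<^sup>+x. emeasure ?N (uminus -` S) * indicator T x \<partial>?M)"
  proof (rule nn_integral_cong_AE, use AE_frame_lborel[OF B] in eventually_elim)
    case (elim x)
    have "(\<integral>\<^sup>+y. indicator S (x - y) \<partial>?N) = (\<integral>\<^sup>+y. indicator S (- y) \<partial>?N)"
      using nn_integral_frame_translate[OF C elim, of "\<lambda>y. indicator S (x - y)"] by simp
    also have "\<dots> = (\<integral>\<^sup>+y. indicator (uminus -` S) y \<partial>?N)"
      by (simp add: indicator_def)
    also have "\<dots> = emeasure ?N (uminus -` S)"
      using mS by simp
    finally show ?case
      by (simp add: nn_integral_multc)
  qed
  also have "\<dots> = emeasure ?N (uminus -` S) * emeasure ?M T"
    by (simp add: nn_integral_cmult)
  finally show ?thesis .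
qed

lemma frame_lborel_unique:
  assumes B: "orthonormal_basis_of E B" and C: "orthonormal_basis_of E C"
  shows "frame_lborel B = frame_lborel C"
proof (rule measure_eqI)
  fix S assume "S \<in> sets (frame_lborel B)"
  then have S: "S \<in> sets borel" by simp
  let ?v = "ennreal (unit_ball_vol (real (dim E)))"
  have v: "?v \<noteq> 0" "?v \<noteq> top"
    using unit_ball_vol_pos[of "real (dim E)"] by (simp_all add: ennreal_eq_0_iff not_le)
  have ball: "emeasure (frame_lborel D) (cball 0 1) = ?v" if "orthonormal_basis_of E D" for D
    using emeasure_frame_cball[OF that, of 1] by simp
  have "emeasure (frame_lborel D) S = emeasure (frame_lborel C) (uminus -` S)"
    if D: "orthonormal_basis_of E D" for D
  proof -
    have "emeasure (frame_lborel D) S * ?v = emeasure (frame_lborel C) (uminus -` S) * ?v"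
      using frame_lborel_haar[OF D C S, of "cball 0 1"] unfolding ball[OF D] ball[OF C] by simp
    then have "emeasure (frame_lborel D) S * ?v / ?v = emeasure (frame_lborel C) (uminus -` S) * ?v / ?v"
      by (rule arg_cong)
    then show ?thesis
      unfolding mult_divide_eq_ennreal[OF v] .
  qed
  from this[OF B] this[OF C] show "emeasure (frame_lborel B) S = emeasure (frame_lborel C) S"
    by simp
qed simp

lemma subspace_lborel_eq:
  assumes "orthonormal_basis_of E B"
  shows "subspace_lborel E = frame_lborel B"
  unfolding subspace_lborel_def
  by (rule frame_lborel_unique[OF someI[of "orthonormal_basis_of E", OF assms] assms])

lemma subspace_lborel_UNIV: "subspace_lborel UNIV = (lborel :: 'a::euclidean_space measure)"
proof -
  have "orthonormal_basis_of UNIV (Basis :: 'a set)"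
    by (auto simp: orthonormal_basis_of_def pairwise_def orthogonal_def inner_not_same_Basis)
  then show ?thesis
    unfolding frame_lborel_def[of Basis, folded lborel_eq, symmetric]
    by (rule subspace_lborel_eq)
qed

lemma subspace_gaussian_UNIV: "subspace_gaussian UNIV = (std_gaussian :: 'a::euclidean_space measure)"
  by (simp add: subspace_gaussian_def std_gaussian_def subspace_lborel_UNIV)

lemma prob_space_subspace_gaussian:
  fixes E :: "'a::euclidean_space set"
  assumes "subspace E"
  shows "prob_space (subspace_gaussian E)"
proof
  obtain B where B: "orthonormal_basis_of E B"
    using orthonormal_basis_of_exists[OF assms] by blast
  note fin = orthonormal_basis_of_finite_card[OF B]
  interpret product_sigma_finite "\<lambda>_::'a. lborel :: real measure" ..
  have eq: "(2 * pi) powr - (real (dim E) / 2) * exp (- (norm (\<Sum>b\<in>B. f b *\<^sub>R b))\<^sup>2 / 2)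
      = (\<Prod>b\<in>B. std_normal_density (f b))" for f
  proof -
    have "(2 * pi) powr - (real (dim E) / 2) = ((2 * pi) powr - (1 / 2)) ^ card B"
      by (simp add: fin powr_powr flip: powr_realpow)
    also have "(2 * pi) powr - (1 / 2) = 1 / sqrt (2 * pi)"
      by (simp add: powr_minus powr_half_sqrt divide_simps)
    finally have c: "(2 * pi) powr - (real (dim E) / 2) = (1 / sqrt (2 * pi)) ^ card B" .
    have "exp (- (norm (\<Sum>b\<in>B. f b *\<^sub>R b))\<^sup>2 / 2) = exp (\<Sum>b\<in>B. - (f b)\<^sup>2 / 2)"
      by (simp add: orthonormal_norm_sum[OF B] sum_negf sum_divide_distrib)
    also have "\<dots> = (\<Prod>b\<in>B. exp (- (f b)\<^sup>2 / 2))"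
      by (rule exp_sum[OF fin(1)])
    finally show ?thesis
      unfolding c std_normal_density_def prod.distrib by simp
  qed
  have one: "(\<integral>\<^sup>+x. ennreal (std_normal_density x) \<partial>lborel) = 1"
    using prob_space.emeasure_space_1[OF prob_space_normal_density[of 1 0]]
    by (simp add: emeasure_density)
  have "emeasure (subspace_gaussian E) (space (subspace_gaussian E))
      = (\<integral>\<^sup>+f. ennreal ((2 * pi) powr - (real (dim E) / 2) * exp (- (norm (\<Sum>b\<in>B. f b *\<^sub>R b))\<^sup>2 / 2))
          \<partial>(\<Pi>\<^sub>M b\<in>B. lborel))"
    unfolding subspace_gaussian_def subspace_lborel_eq[OF B] frame_lborel_def
    by (simp add: emeasure_density nn_integral_distr)
  also have "\<dots> = (\<integral>\<^sup>+f. (\<Prod>b\<in>B. ennreal (std_normal_density (f b))) \<partial>(\<Pi>\<^sub>M b\<in>B. lborel))"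
    unfolding eq by (simp add: prod_ennreal)
  also have "\<dots> = 1"
    using fin by (subst product_nn_integral_prod) (simp_all add: one)
  finally show "emeasure (subspace_gaussian E) (space (subspace_gaussian E)) = 1" .
qed

end

theory Submission
  imports Defs
begin

text \<open>
  Let \<open>v\<^sub>i\<close> be the coordinates of the projections of the standard basis vectors in an orthonormal
  basis of \<open>E\<close>. They form a Parseval frame of \<open>\<real>\<^sup>k\<close>, the left-hand side is the Gaussian measure of
  the intersection of the slabs \<open>\<bar>x \<bullet> v\<^sub>i\<bar> \<le> r\<close>, and the geometric Brascamp-Lieb inequality bounds it
  by the product of the numbers \<open>\<gamma>\<^sub>1[-r/\<surd>c\<^sub>i, r/\<surd>c\<^sub>i]\<close> to the powers \<open>c\<^sub>i = \<bar>v\<^sub>i\<bar>\<^sup>2\<close>.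

  Brascamp-Lieb follows by transport, after Barthe: if \<open>S\<^sub>i\<close> is the suitably rescaled monotone map
  carrying the Gaussian restricted to an interval onto the full Gaussian, then
  \<open>\<Theta>(x) = \<Sum> S\<^sub>i(x \<bullet> v\<^sub>i) v\<^sub>i\<close> is injective on the open slabs,
  \<open>\<bar>\<Theta>(x)\<bar>\<^sup>2 \<le> \<Sum> S\<^sub>i(x \<bullet> v\<^sub>i)\<^sup>2\<close>, and its Jacobian is at least the product of the \<open>S\<^sub>i'\<close> to the powers \<open>c\<^sub>i\<close>,
  by Cauchy-Binet and Jensen.

  Since the \<open>c\<^sub>i\<close> sum to \<open>k\<close>, the product is largest when all of them equal \<open>k/n\<close>:
  \<open>s \<mapsto> ln \<gamma>\<^sub>1[-r\<surd>s, r\<surd>s]\<close> is concave, and it suffices to use its tangent at \<open>s = n/k\<close>.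
\<close>

subsection \<open>A determinant inequality\<close>

text \<open>Expand one of the two determinant factors by Leibniz. Replacing \<open>f\<close> by
  \<open>f \<circ> p\<close> turns the term of \<open>p\<close> into that of the identity: the sign
  of \<open>p\<close> meets the same sign from the permuted rows. So all permutations contribute
  equally, whence the factorial.\<close>

lemma det_sum_symmetrize:
  fixes v :: "'n::finite \<Rightarrow> real ^ 'k" and w :: "('k \<Rightarrow> 'n) \<Rightarrow> real"
  assumes w: "\<And>p f. p permutes UNIV \<Longrightarrow> w (f \<circ> p) = w f"
  shows "(\<Sum>f\<in>UNIV. w f * (det (\<chi> j. v (f j)))\<^sup>2)
       = fact CARD('k) * (\<Sum>f\<in>UNIV. w f * ((\<Prod>j\<in>UNIV. v (f j) $ j) * det (\<chi> j. v (f j))))"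
proof -
  let ?P = "{p. p permutes (UNIV :: 'k set)}"
  let ?S = "\<lambda>p f. w f * ((of_int (sign p) * (\<Prod>i\<in>UNIV. v (f i) $ p i)) * det (\<chi> j. v (f j)))"
  let ?T = "\<lambda>f. w f * ((\<Prod>j\<in>UNIV. v (f j) $ j) * det (\<chi> j. v (f j)))"
  have eq: "(\<Sum>f\<in>UNIV. ?S p f) = (\<Sum>f\<in>UNIV. ?T f)" if p: "p permutes UNIV" for p
  proof -
    have bij: "bij_betw (\<lambda>f. f \<circ> p) (UNIV :: ('k \<Rightarrow> 'n) set) UNIV"
      by (rule bij_betw_byWitness[where f' = "\<lambda>f. f \<circ> inv p"])
         (use p in \<open>auto simp: comp_assoc permutes_inv_o\<close>)
    have "?S p (f \<circ> p) = ?T f" for f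
    proof -
      have d: "det (\<chi> j. v ((f \<circ> p) j)) = of_int (sign p) * det (\<chi> j. v (f j))"
        using det_permute_rows[OF p, of "\<chi> j. v (f j)"] by simp
      have pr: "(\<Prod>i\<in>UNIV. v ((f \<circ> p) i) $ p i) = (\<Prod>j\<in>UNIV. v (f j) $ j)"
        using prod.permute[OF p, of "\<lambda>j. v (f j) $ j"] by (simp add: o_def)
      have s: "of_int (sign p) * (of_int (sign p) * x) = (x :: real)" for x
        by (simp add: mult.assoc[symmetric] sign_idempotent flip: of_int_mult)
      show ?thesis
        unfolding d pr w[OF p] by (simp add: s algebra_simps)
    qed
    then show ?thesis
      using sum.reindex_bij_betw[OF bij, of "?S p"] by simp
  qed
  have "(\<Sum>f\<in>UNIV. w f * (det (\<chi> j. v (f j)))\<^sup>2) = (\<Sum>f\<in>UNIV. \<Sum>p\<in>?P. ?S p f)"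
    unfolding power2_eq_square
    by (subst (1) det_def) (simp add: sum_distrib_left sum_distrib_right)
  also have "\<dots> = (\<Sum>p\<in>?P. \<Sum>f\<in>UNIV. ?S p f)"
    by (rule sum.swap)
  also have "\<dots> = (\<Sum>p\<in>?P. \<Sum>f\<in>UNIV. ?T f)"
    by (rule sum.cong) (use eq in auto)
  also have "\<dots> = fact CARD('k) * (\<Sum>f\<in>UNIV. ?T f)"
    by (simp add: card_permutations)
  finally show ?thesis .
qed

text \<open>The coefficients may depend on the row, so that \<open>frame_det_weight\<close> can
  change a single row.\<close>

lemma det_rows_multilinear:
  fixes v :: "'n::finite \<Rightarrow> real ^ 'k" and c :: "'k \<Rightarrow> 'n \<Rightarrow> real"
  shows "det (\<chi> j. \<Sum>i\<in>UNIV. (c j i * v i $ j) *\<^sub>R v i)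
       = (\<Sum>f\<in>UNIV. (\<Prod>j\<in>UNIV. c j (f j)) * ((\<Prod>j\<in>UNIV. v (f j) $ j) * det (\<chi> j. v (f j))))"
proof -
  have "det (\<chi> j. \<Sum>i\<in>UNIV. (c j i * v i $ j) *\<^sub>R v i)
      = (\<Sum>f\<in>UNIV. det (\<chi> j. (c j (f j) * v (f j) $ j) *s v (f j)))"
    unfolding det_def
    by (simp add: prod_sum_PiE[of UNIV "\<lambda>_. UNIV", simplified] sum_distrib_left scalar_mult_eq_scaleR)
       (rule sum.swap)
  then show ?thesis
    by (simp add: det_rows_mul prod.distrib mult.assoc)
qed

text \<open>Cauchy-Binet for the matrix that sums \<open>l i\<close> times the rank-one matrix of
  \<open>v i\<close>. Summing over all maps \<open>f\<close> instead of subsets counts each subset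
  once per ordering, hence the factorial; non-injective maps give a zero determinant.\<close>

lemma cauchy_binet_frame:
  fixes v :: "'n::finite \<Rightarrow> real ^ 'k" and l :: "'n \<Rightarrow> real"
  shows "fact CARD('k) * det (\<chi> j. \<Sum>i\<in>UNIV. (l i * v i $ j) *\<^sub>R v i)
       = (\<Sum>f\<in>UNIV. (\<Prod>j\<in>UNIV. l (f j)) * (det (\<chi> j. v (f j)))\<^sup>2)"
proof -
  have "(\<Prod>j\<in>UNIV. l ((f \<circ> p) j)) = (\<Prod>j\<in>UNIV. l (f j))" if "p permutes UNIV" for p and f :: "'k \<Rightarrow> 'n"
    using prod.permute[OF that, of "\<lambda>j. l (f j)"] by (simp add: o_def)
  then show ?thesis
    unfolding det_rows_multilinear by (subst det_sum_symmetrize) auto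
qed

text \<open>The weights of the Jensen step below are \<open>det\<^sup>2 / k!\<close>; each vector occurs with total weight
  its squared length.\<close>

lemma frame_det_weight:
  fixes v :: "'n::finite \<Rightarrow> real ^ 'k"
  assumes frame: "\<And>j. (\<Sum>i\<in>UNIV. v i $ j *\<^sub>R v i) = axis j 1"
  shows "(\<Sum>f\<in>UNIV. (\<Sum>j\<in>UNIV. g (f j)) * (det (\<chi> j. v (f j)))\<^sup>2)
       = fact CARD('k) * (\<Sum>i\<in>UNIV. g i * (norm (v i))\<^sup>2)"
proof -
  have perm: "(\<Sum>j\<in>UNIV. g ((f \<circ> p) j)) = (\<Sum>j\<in>UNIV. g (f j))" if "p permutes UNIV" for p and f :: "'k \<Rightarrow> 'n"
    using sum.permute[OF that, of "\<lambda>j. g (f j)"] by (simp add: o_def)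
  have one: "(\<Sum>f\<in>UNIV. g (f l) * ((\<Prod>j\<in>UNIV. v (f j) $ j) * det (\<chi> j. v (f j))))
      = (\<Sum>i\<in>UNIV. g i * (v i $ l)\<^sup>2)" for l
  proof -
    let ?x = "\<Sum>i\<in>UNIV. (g i * v i $ l) *\<^sub>R v i"
    have "(\<Sum>f\<in>UNIV. g (f l) * ((\<Prod>j\<in>UNIV. v (f j) $ j) * det (\<chi> j. v (f j))))
        = det (\<chi> j. \<Sum>i\<in>UNIV. ((if j = l then g i else 1) * v i $ j) *\<^sub>R v i)"
      unfolding det_rows_multilinear by (simp add: prod.delta)
    \<comment> \<open>By the frame identity every row except \<open>l\<close> is a row of the
      identity matrix. Row \<open>l\<close> is \<open>?x\<close>, written in the form required by
      \<open>cramer_lemma_transpose\<close>, and the determinant is the entry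
      \<open>?x $ l\<close>.\<close>
    also have "(\<chi> j. \<Sum>i\<in>UNIV. ((if j = l then g i else 1) * v i $ j) *\<^sub>R v i)
        = (\<chi> j. if j = l then (\<Sum>i\<in>UNIV. ?x $ i *s row i (mat 1)) else row j (mat 1))"
    proof -
      have "row i (mat 1 :: real ^ 'k ^ 'k) = axis i 1" for i
        by (simp add: row_def mat_def axis_def vec_eq_iff)
      then have "(\<Sum>i\<in>UNIV. ?x $ i *s row i (mat 1)) = ?x" "\<And>j. row j (mat 1) = (\<Sum>i\<in>UNIV. v i $ j *\<^sub>R v i)"
        using basis_expansion[of ?x] by (simp_all add: frame axis_def)
      then show ?thesis
        by (simp add: vec_eq_iff)
    qed
    also have "det \<dots> = ?x $ l"
      by (subst cramer_lemma_transpose) simp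
    finally show ?thesis
      by (simp add: power2_eq_square mult.assoc)
  qed
  have "(\<Sum>f\<in>UNIV. (\<Sum>j\<in>UNIV. g (f j)) * (det (\<chi> j. v (f j)))\<^sup>2)
      = fact CARD('k) * (\<Sum>f\<in>UNIV. (\<Sum>l\<in>UNIV. g (f l)) * ((\<Prod>j\<in>UNIV. v (f j) $ j) * det (\<chi> j. v (f j))))"
    using perm by (rule det_sum_symmetrize)
  also have "\<dots> = fact CARD('k) * (\<Sum>l\<in>UNIV. \<Sum>f\<in>UNIV. g (f l) * ((\<Prod>j\<in>UNIV. v (f j) $ j) * det (\<chi> j. v (f j))))"
    unfolding sum_distrib_right by (subst sum.swap) simp
  also have "\<dots> = fact CARD('k) * (\<Sum>l\<in>UNIV. \<Sum>i\<in>UNIV. g i * (v i $ l)\<^sup>2)"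
    by (simp only: one)
  also have "\<dots> = fact CARD('k) * (\<Sum>i\<in>UNIV. g i * (\<Sum>l\<in>UNIV. (v i $ l)\<^sup>2))"
    by (subst sum.swap) (simp add: sum_distrib_left)
  also have "(\<lambda>i. \<Sum>l\<in>UNIV. (v i $ l)\<^sup>2) = (\<lambda>i. (norm (v i))\<^sup>2)"
    unfolding power2_norm_eq_inner inner_vec_def by (simp add: power2_eq_square)
  finally show ?thesis .
qed

text \<open>Jensen for \<open>exp\<close> with the weights \<open>?p\<close>, which sum to 1 by
  Cauchy-Binet with \<open>l = 1\<close>. The mean of the exponents is given by
  \<open>frame_det_weight\<close>, the mean of the exponentials is the determinant.\<close>

lemma det_frame_ge:
  fixes v :: "'n::finite \<Rightarrow> real ^ 'k" and l :: "'n \<Rightarrow> real"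
  assumes frame: "\<And>j. (\<Sum>i\<in>UNIV. v i $ j *\<^sub>R v i) = axis j 1" and l: "\<And>i. 0 < l i"
  shows "exp (\<Sum>i\<in>UNIV. (norm (v i))\<^sup>2 * ln (l i)) \<le> det (\<chi> j. \<Sum>i\<in>UNIV. (l i * v i $ j) *\<^sub>R v i)"
proof -
  let ?p = "\<lambda>f :: 'k \<Rightarrow> 'n. (det (\<chi> j. v (f j)))\<^sup>2 / fact CARD('k)"
  let ?y = "\<lambda>f :: 'k \<Rightarrow> 'n. \<Sum>j\<in>UNIV. ln (l (f j))"
  have "(\<chi> j. \<Sum>i\<in>UNIV. v i $ j *\<^sub>R v i) = (mat 1 :: real ^ 'k ^ 'k)"
    by (simp add: frame mat_def axis_def vec_eq_iff)
  then have "(\<Sum>f\<in>UNIV. (det (\<chi> j. v (f j)))\<^sup>2) = fact CARD('k)"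
    using cauchy_binet_frame[of "\<lambda>_. 1" v] by simp
  then have one: "(\<Sum>f\<in>UNIV. ?p f) = 1"
    by (simp flip: sum_divide_distrib)
  have "(\<Sum>f\<in>UNIV. ?p f *\<^sub>R ?y f) = (\<Sum>i\<in>UNIV. (norm (v i))\<^sup>2 * ln (l i))"
    using frame_det_weight[OF frame, of "\<lambda>i. ln (l i)"]
    by (simp add: mult.commute[of "(_)\<^sup>2"] flip: sum_divide_distrib)
  moreover have "exp (\<Sum>f\<in>UNIV. ?p f *\<^sub>R ?y f) \<le> (\<Sum>f\<in>UNIV. ?p f * exp (?y f))"
    using one by (intro convex_on_sum[OF _ _ exp_convex]) auto
  moreover have "exp (?y f) = (\<Prod>j\<in>UNIV. l (f j))" for f
    using l by (simp add: exp_sum)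
  ultimately have "fact CARD('k) * exp (\<Sum>i\<in>UNIV. (norm (v i))\<^sup>2 * ln (l i))
      \<le> fact CARD('k) * det (\<chi> j. \<Sum>i\<in>UNIV. (l i * v i $ j) *\<^sub>R v i)"
    unfolding cauchy_binet_frame by (simp add: mult.commute field_simps flip: sum_divide_distrib)
  then show ?thesis
    by simp
qed

subsection \<open>The normal distribution on the line\<close>

abbreviation normal_cdf :: "real \<Rightarrow> real" where
  "normal_cdf \<equiv> cdf std_normal_distribution"

text \<open>For positive \<open>a\<close> this is the Gaussian measure of the interval from
  \<open>-a\<close> to \<open>a\<close>; the form through the distribution function makes it easy to
  differentiate.\<close>

definition normal_interval :: "real \<Rightarrow> real" where
  "normal_interval a = normal_cdf a - normal_cdf (- a)"

lemma continuous_on_std_normal_density: "continuous_on A std_normal_density"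
  unfolding std_normal_density_def by (intro continuous_intros) auto

lemma emeasure_std_normal_Ioc:
  assumes "s < t"
  shows "emeasure std_normal_distribution {s<..t} = ennreal (integral {s..t} std_normal_density)"
proof -
  have "std_normal_density integrable_on {s..t}"
    by (intro integrable_continuous_interval continuous_on_std_normal_density)
  then have "(std_normal_density has_integral integral {s..t} std_normal_density) {s..t}"
    by (rule integrable_integral)
  then have "((\<lambda>x. std_normal_density x * indicator {s<..t} x) has_integral integral {s..t} std_normal_density) {s..t}"
    by (rule has_integral_spike_finite[of "{s}", rotated -1]) (auto simp: indicator_def)
  then have "((\<lambda>x. std_normal_density x * indicator {s<..t} x) has_integral integral {s..t} std_normal_density) UNIV"
    by (rule has_integral_on_superset) (auto simp: indicator_def)
  then have "(\<integral>\<^sup>+x. ennreal (std_normal_density x * indicator {s<..t} x) \<partial>lborel) = integral {s..t} std_normal_density"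
    by (intro nn_integral_has_integral_lborel) auto
  then show ?thesis
    by (simp add: emeasure_density ennreal_mult ennreal_indicator)
qed

lemma normal_cdf_eq_integral:
  assumes "s < t"
  shows "normal_cdf t = normal_cdf s + integral {s..t} std_normal_density"
proof -
  interpret real_distribution std_normal_distribution
    by (rule real_dist_normal_dist)
  have "0 \<le> integral {s..t} std_normal_density"
    by (intro integral_nonneg integrable_continuous_interval continuous_on_std_normal_density) auto
  then have "measure std_normal_distribution {s<..t} = integral {s..t} std_normal_density"
    by (simp add: measure_def emeasure_std_normal_Ioc[OF assms])
  then show ?thesis
    using cdf_diff_eq[OF assms] by simp
qed

lemma DERIV_normal_cdf: "(normal_cdf has_real_derivative std_normal_density x) (at x)"
proof -
  \<comment> \<open>Integration starts at \<open>x - 1\<close> to make \<open>x\<close> an interior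
    point; the constant \<open>normal_cdf (x - 1)\<close> then recovers the distribution
    function.\<close>
  have "((\<lambda>t. integral {x - 1..t} std_normal_density) has_real_derivative std_normal_density x)
      (at x within {x - 1..x + 1})"
    by (rule integral_has_real_derivative) (auto intro: continuous_on_std_normal_density)
  then have "((\<lambda>t. integral {x - 1..t} std_normal_density) has_real_derivative std_normal_density x) (at x)"
    by (simp add: at_within_Icc_at)
  then have "((\<lambda>t. normal_cdf (x - 1) + integral {x - 1..t} std_normal_density)
      has_real_derivative std_normal_density x) (at x)"
    by (auto intro!: derivative_eq_intros)
  then show ?thesis
    by (rule has_field_derivative_transform_within_open[of _ _ _ "{x - 1<..<x + 1}"])
       (auto simp: normal_cdf_eq_integral[of "x - 1"])
qed

lemma std_normal_density_pos: "0 < std_normal_density x"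
  by (simp add: normal_density_pos)

lemma normal_cdf_strict_mono: "strict_mono normal_cdf"
  by (rule strict_monoI, rule DERIV_pos_imp_increasing)
     (auto intro: DERIV_normal_cdf std_normal_density_pos)

lemma inj_normal_cdf: "inj normal_cdf"
  by (rule strict_mono_imp_inj_on[OF normal_cdf_strict_mono])

lemma normal_cdf_surj:
  assumes "0 < y" "y < 1"
  obtains x where "normal_cdf x = y"
proof -
  interpret real_distribution std_normal_distribution
    by (rule real_dist_normal_dist)
  have "eventually (\<lambda>x. normal_cdf x < y) at_bot"
    using cdf_lim_at_bot assms by (simp add: order_tendstoD)
  then obtain a where a: "normal_cdf a < y"
    by (metis eventually_happens trivial_limit_at_bot_linorder)
  have "eventually (\<lambda>x. y < normal_cdf x) at_top"
    using cdf_lim_at_top_prob assms by (simp add: order_tendstoD)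
  then obtain b where b: "y < normal_cdf b"
    by (metis eventually_happens trivial_limit_at_top_linorder)
  have "a \<le> b"
    using a b normal_cdf_strict_mono by (meson less_le_trans not_le order_less_asym strict_mono_less)
  moreover have "isCont normal_cdf x" for x
    using DERIV_normal_cdf by (rule DERIV_isCont)
  ultimately show thesis
    using IVT[of normal_cdf a y b] a b that by auto
qed

lemma DERIV_normal_quantile:
  assumes "0 < y" "y < 1"
  shows "(inv normal_cdf has_real_derivative inverse (std_normal_density (inv normal_cdf y))) (at y)"
proof (rule DERIV_inverse_function[OF _ _ assms])
  obtain x where x: "normal_cdf x = y"
    using normal_cdf_surj[OF assms] .
  have "isCont (inv normal_cdf) (normal_cdf x)"
    by (rule isCont_inverse_function[of 1])
       (auto simp: inv_f_f[OF inj_normal_cdf] intro: DERIV_isCont DERIV_normal_cdf)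
  then show "isCont (inv normal_cdf) y"
    by (simp add: x)
  show "normal_cdf (inv normal_cdf z) = z" if "0 < z" "z < 1" for z
    using normal_cdf_surj[OF that] by (metis f_inv_into_f rangeI)
qed (use DERIV_normal_cdf std_normal_density_pos in \<open>auto simp: less_imp_neq[symmetric]\<close>)

lemma normal_interval_pos: "0 < a \<Longrightarrow> 0 < normal_interval a"
  using strict_monoD[OF normal_cdf_strict_mono, of "- a" a] by (simp add: normal_interval_def)

text \<open>\<open>T\<close> is the normal quantile of \<open>?F\<close>, the distribution function
  of the normal law conditioned on the interval. Differentiating gives
  \<open>density t = Z * T' t * density (T t)\<close>; the third property is its logarithm with the
  common constant cancelled.\<close>

lemma normal_interval_transport:
  assumes a: "0 < a"
  obtains T T' where
    "\<And>t. \<bar>t\<bar> < a \<Longrightarrow> (T has_real_derivative T' t) (at t)"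
    "\<And>t. \<bar>t\<bar> < a \<Longrightarrow> 0 < T' t"
    "\<And>t. \<bar>t\<bar> < a \<Longrightarrow> - t\<^sup>2 / 2 = ln (normal_interval a) + ln (T' t) - (T t)\<^sup>2 / 2"
proof
  let ?Z = "normal_interval a"
  let ?F = "\<lambda>t. (normal_cdf t - normal_cdf (- a)) / ?Z"
  let ?T = "\<lambda>t. inv normal_cdf (?F t)"
  let ?T' = "\<lambda>t. std_normal_density t / (?Z * std_normal_density (?T t))"
  fix t assume t: "\<bar>t\<bar> < a"
  have Z: "0 < ?Z"
    using a by (rule normal_interval_pos)
  have F: "0 < ?F t" "?F t < 1"
    using t strict_monoD[OF normal_cdf_strict_mono, of "- a" t]
      strict_monoD[OF normal_cdf_strict_mono, of t a] Z
    by (simp_all add: abs_less_iff divide_less_eq) (simp add: normal_interval_def)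
  have "(?F has_real_derivative std_normal_density t / ?Z) (at t)"
    using Z by (auto intro!: derivative_eq_intros DERIV_normal_cdf)
  from DERIV_chain2[OF DERIV_normal_quantile[OF F] this]
  show "(?T has_real_derivative ?T' t) (at t)"
    by (simp add: field_simps)
  show "0 < ?T' t"
    using Z std_normal_density_pos[of t] std_normal_density_pos[of "?T t"] by simp
  have ln: "ln (std_normal_density x) = - ln (sqrt (2 * pi)) - x\<^sup>2 / 2" for x
    by (simp add: std_normal_density_def ln_div ln_mult)
  show "- t\<^sup>2 / 2 = ln ?Z + ln (?T' t) - (?T t)\<^sup>2 / 2"
    using Z std_normal_density_pos[of t] std_normal_density_pos[of "?T t"]
    by (simp add: ln_div ln_mult ln)
qed

text \<open>Take \<open>S s = sqrt c * T (s / sqrt c)\<close> and multiply the logarithmic identity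
  by \<open>c\<close>. The case \<open>c = 0\<close> stands for a zero vector, whose inner products
  are all 0, so any map fixing 0 with positive derivative there will do.\<close>

lemma scaled_normal_interval_transport:
  assumes c: "0 \<le> c" and r: "0 < r"
  shows "\<exists>S S'. \<forall>s. \<bar>s\<bar> < r \<and> (c = 0 \<longrightarrow> s = 0) \<longrightarrow>
    (S has_real_derivative S' s) (at s) \<and> 0 < S' s \<and>
    - s\<^sup>2 / 2 = c * ln (normal_interval (r / sqrt c)) + c * ln (S' s) - (S s)\<^sup>2 / 2"
proof (cases "c = 0")
  case True
  then show ?thesis
    by (intro exI[of _ "\<lambda>s. s"] exI[of _ "\<lambda>s. 1"]) auto
next
  case False
  with c have c: "0 < c"
    by simp
  obtain T T' where T:
    "\<And>t. \<bar>t\<bar> < r / sqrt c \<Longrightarrow> (T has_real_derivative T' t) (at t)"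
    "\<And>t. \<bar>t\<bar> < r / sqrt c \<Longrightarrow> 0 < T' t"
    "\<And>t. \<bar>t\<bar> < r / sqrt c \<Longrightarrow> - t\<^sup>2 / 2 = ln (normal_interval (r / sqrt c)) + ln (T' t) - (T t)\<^sup>2 / 2"
    using normal_interval_transport[of "r / sqrt c"] c r by auto
  show ?thesis
  proof (rule exI[of _ "\<lambda>s. sqrt c * T (s / sqrt c)"], rule exI[of _ "\<lambda>s. T' (s / sqrt c)"],
      intro allI impI conjI)
    fix s assume "\<bar>s\<bar> < r \<and> (c = 0 \<longrightarrow> s = 0)"
    then have s: "\<bar>s / sqrt c\<bar> < r / sqrt c"
      using c by (simp add: divide_strict_right_mono)
    from DERIV_cmult[OF DERIV_chain2[OF T(1)[OF s] DERIV_cdivide[OF DERIV_ident]], of "sqrt c"]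
    show "((\<lambda>s. sqrt c * T (s / sqrt c)) has_real_derivative T' (s / sqrt c)) (at s)"
      using c by simp
    show "0 < T' (s / sqrt c)"
      by (rule T(2)[OF s])
    show "- s\<^sup>2 / 2 = c * ln (normal_interval (r / sqrt c)) + c * ln (T' (s / sqrt c))
        - (sqrt c * T (s / sqrt c))\<^sup>2 / 2"
      using arg_cong[OF T(3)[OF s], of "\<lambda>x. c * x"] c
      by (simp add: power_mult_distrib power_divide algebra_simps)
  qed
qed

section \<open>Concavity and the optimal choice of weights\<close>

lemma DERIV_normal_interval_sqrt:
  assumes "0 < s"
  shows "((\<lambda>s. normal_interval (r * sqrt s)) has_real_derivative
    std_normal_density (r * sqrt s) * (r / sqrt s)) (at s)"
proof -
  have "std_normal_density (- x) = std_normal_density x" for x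
    by (simp add: std_normal_density_def)
  then show ?thesis
    unfolding normal_interval_def using assms
    by (auto intro!: derivative_eq_intros DERIV_chain2[OF DERIV_normal_cdf] simp: field_simps)
qed

text \<open>The derivative decreases in \<open>s\<close>, since both the density at
  \<open>r * sqrt s\<close> and \<open>r / sqrt s\<close> do; a concave function lies below its
  tangents.\<close>

lemma normal_interval_sqrt_tangent:
  assumes r: "0 < r" and s: "0 < s" and t: "0 < t"
  shows "normal_interval (r * sqrt t)
    \<le> normal_interval (r * sqrt s) + std_normal_density (r * sqrt s) * (r / sqrt s) * (t - s)"
proof -
  let ?d = "\<lambda>s. std_normal_density (r * sqrt s) * (r / sqrt s)"
  have "?d y \<le> ?d x" if "0 < x" "x \<le> y" for x y
    using that r by (intro mult_mono divide_left_mono)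
      (auto simp: std_normal_density_def power_mult_distrib divide_right_mono)
  then have "convex_on {0<..} (\<lambda>s. - normal_interval (r * sqrt s))"
    by (intro convex_on_realI[where f' = "\<lambda>s. - ?d s"] DERIV_minus DERIV_normal_interval_sqrt) auto
  from convex_on_imp_above_tangent[OF this, of s t "- ?d s"]
  show ?thesis
    using s t DERIV_minus[OF DERIV_normal_interval_sqrt[OF s, of r]]
    by (simp add: interior_open has_field_derivative_at_within algebra_simps)
qed

text \<open>Use the tangent at \<open>s = card I / k\<close> for the argument
  \<open>1 / c i\<close>, then \<open>ln x \<le> x - 1\<close>. After multiplication by
  \<open>c i\<close> the bound is affine in \<open>c i\<close>, and this \<open>s\<close> makes the
  slope terms sum to zero.\<close>

lemma sum_ln_normal_interval_le:
  assumes I: "finite I" and r: "0 < r" and c: "\<And>i. i \<in> I \<Longrightarrow> 0 \<le> c i"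
    and k: "(\<Sum>i\<in>I. c i) = k" "0 < k"
  shows "(\<Sum>i\<in>I. c i * ln (normal_interval (r / sqrt (c i))))
    \<le> k * ln (normal_interval (r * sqrt (card I / k)))"
proof -
  define s where "s = card I / k"
  define Z where "Z = normal_interval (r * sqrt s)"
  \<comment> \<open>The logarithmic derivative of \<open>normal_interval (r * sqrt s)\<close> in
    \<open>s\<close>.\<close>
  define m where "m = std_normal_density (r * sqrt s) * (r / sqrt s) / Z"
  have "I \<noteq> {}"
    using k by auto
  then have s: "0 < s"
    using I k by (simp add: card_gt_0_iff s_def)
  then have Z: "0 < Z"
    using r unfolding Z_def by (intro normal_interval_pos) simp
  have m: "0 \<le> m"
    using Z s r std_normal_density_pos[of "r * sqrt s"] by (simp add: m_def)
  have "c i * ln (normal_interval (r / sqrt (c i))) \<le> c i * ln Z + m * (1 - c i * s)" if "i \<in> I" for i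
  proof (cases "c i = 0")
    case True
    then show ?thesis
      using m by simp
  next
    case False
    then have ci: "0 < c i"
      using c[OF that] by simp
    then have Zi: "0 < normal_interval (r / sqrt (c i))"
      using r by (intro normal_interval_pos) simp
    have "m * Z = std_normal_density (r * sqrt s) * (r / sqrt s)"
      using Z by (simp add: m_def)
    moreover have "normal_interval (r / sqrt (c i))
        \<le> Z + std_normal_density (r * sqrt s) * (r / sqrt s) * (1 / c i - s)"
      using normal_interval_sqrt_tangent[OF r s, of "1 / c i"] ci by (simp add: real_sqrt_divide Z_def)
    ultimately have "normal_interval (r / sqrt (c i)) \<le> Z + m * Z * (1 / c i - s)"
      by (simp only:)
    then have "normal_interval (r / sqrt (c i)) / Z \<le> 1 + m * (1 / c i - s)"
      using Z by (simp add: divide_le_eq distrib_left mult_ac)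
    moreover have "ln (normal_interval (r / sqrt (c i)) / Z) \<le> normal_interval (r / sqrt (c i)) / Z - 1"
      using Z Zi by (intro ln_le_minus_one) simp
    ultimately have "ln (normal_interval (r / sqrt (c i))) \<le> ln Z + m * (1 / c i - s)"
      using Z Zi by (simp add: ln_div)
    then have "c i * ln (normal_interval (r / sqrt (c i))) \<le> c i * (ln Z + m * (1 / c i - s))"
      using ci by (intro mult_left_mono) auto
    also have "\<dots> = c i * ln Z + m * (1 - c i * s)"
      using ci by (simp add: distrib_left right_diff_distrib)
    finally show ?thesis .
  qed
  then have "(\<Sum>i\<in>I. c i * ln (normal_interval (r / sqrt (c i))))
      \<le> (\<Sum>i\<in>I. c i * ln Z + m * (1 - c i * s))"
    by (rule sum_mono)
  also have "\<dots> = k * ln Z + m * (real (card I) - k * s)"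
    by (simp add: sum.distrib sum_subtractf k(1) flip: sum_distrib_left sum_distrib_right)
  finally show ?thesis
    using k by (simp add: s_def Z_def)
qed

subsection \<open>The Brascamp-Lieb inequality\<close>

text \<open>The density of \<open>std_gaussian\<close> as a real function, for use with gauge
  integrals and change of variables.\<close>

definition gaussian_density :: "'a::euclidean_space \<Rightarrow> real" where
  "gaussian_density x = (2 * pi) powr - (real DIM('a) / 2) * exp (- (norm x)\<^sup>2 / 2)"

lemma gaussian_density_nonneg: "0 \<le> gaussian_density x"
  by (simp add: gaussian_density_def)

lemma borel_measurable_gaussian_density [measurable]: "gaussian_density \<in> borel_measurable borel"
  unfolding gaussian_density_def by measurable

lemma std_gaussian_eq: "std_gaussian = density lborel (\<lambda>x. ennreal (gaussian_density x))"
  by (simp add: std_gaussian_def gaussian_density_def)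

lemma nn_integral_gaussian_density:
  "(\<integral>\<^sup>+x. ennreal (gaussian_density x) \<partial>(lborel :: 'a::euclidean_space measure)) = 1"
proof -
  have "prob_space (std_gaussian :: 'a measure)"
    using prob_space_subspace_gaussian[OF subspace_UNIV] by (simp add: subspace_gaussian_UNIV)
  then show ?thesis
    by (auto dest: prob_space.emeasure_space_1 simp: std_gaussian_eq emeasure_density)
qed

lemma gaussian_density_has_integral: "(gaussian_density has_integral 1) UNIV"
  by (rule nn_integral_has_integral) (auto simp: nn_integral_gaussian_density gaussian_density_nonneg)

lemma gaussian_density_absolutely_integrable: "gaussian_density absolutely_integrable_on UNIV"
  using gaussian_density_has_integral
  by (subst absolutely_integrable_on_iff_nonneg) (auto simp: gaussian_density_nonneg)

text \<open>The scalar integrand is carried through \<open>real ^ 1\<close> to apply the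
  vector-valued change of variables theorem.\<close>

lemma integral_change_of_variables_real:
  fixes f :: "real ^ 'm::{finite,wellorder} \<Rightarrow> real" and g :: "real ^ 'm::_ \<Rightarrow> real ^ 'm::_"
  assumes "S \<in> sets lebesgue" "\<And>x. x \<in> S \<Longrightarrow> (g has_derivative g' x) (at x within S)"
    "inj_on g S" "f absolutely_integrable_on (g ` S)"
  shows "(\<lambda>x. \<bar>det (matrix (g' x))\<bar> * f (g x)) absolutely_integrable_on S"
    and "integral S (\<lambda>x. \<bar>det (matrix (g' x))\<bar> * f (g x)) = integral (g ` S) f"
proof -
  have f: "(\<lambda>x. vec (f x) :: real ^ 1) absolutely_integrable_on (g ` S)"
    using assms(4) by (simp add: absolutely_integrable_on_1_iff)
  from has_absolute_integral_change_of_variables[OF assms(1-3), of "\<lambda>x. vec (f x) :: real ^ 1" "integral (g ` S) (\<lambda>x. vec (f x))"] f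
  show "(\<lambda>x. \<bar>det (matrix (g' x))\<bar> * f (g x)) absolutely_integrable_on S"
    and "integral S (\<lambda>x. \<bar>det (matrix (g' x))\<bar> * f (g x)) = integral (g ` S) f"
    by (simp_all add: absolutely_integrable_on_1_iff integral_on_1_eq vec_eq_iff)
qed

text \<open>The assumption says, column by column, that the rank-one matrices of the
  \<open>v i\<close> sum to the identity. Some \<open>v i\<close> may be zero.\<close>

locale parseval_frame =
  fixes v :: "'n::finite \<Rightarrow> real ^ 'k"
  assumes frame: "\<And>j. (\<Sum>i\<in>UNIV. v i $ j *\<^sub>R v i) = axis j 1"
begin

lemma expansion: "(\<Sum>i\<in>UNIV. (x \<bullet> v i) *\<^sub>R v i) = x"
proof -
  have "(\<Sum>i\<in>UNIV. (x \<bullet> v i) *\<^sub>R v i) = (\<Sum>i\<in>UNIV. \<Sum>j\<in>UNIV. x $ j *\<^sub>R (v i $ j *\<^sub>R v i))"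
    by (simp add: inner_vec_def scaleR_sum_left)
  also have "\<dots> = (\<Sum>j\<in>UNIV. x $ j *\<^sub>R axis j 1)"
    by (subst sum.swap) (simp only: scaleR_sum_right[symmetric] frame)
  also have "\<dots> = x"
    using basis_expansion[of x] by (simp add: scalar_mult_eq_scaleR axis_def)
  finally show ?thesis .
qed

lemma inner_expansion: "x \<bullet> y = (\<Sum>i\<in>UNIV. (x \<bullet> v i) * (v i \<bullet> y))"
proof -
  have "x \<bullet> y = (\<Sum>i\<in>UNIV. (x \<bullet> v i) *\<^sub>R v i) \<bullet> y"
    by (simp only: expansion)
  then show ?thesis
    by (simp add: inner_sum_left)
qed

lemma norm_expansion: "(norm x)\<^sup>2 = (\<Sum>i\<in>UNIV. (x \<bullet> v i)\<^sup>2)"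
  unfolding power2_norm_eq_inner inner_expansion[of x x] by (simp add: power2_eq_square inner_commute)

text \<open>Write the left side as the sum of \<open>a i * (?y \<bullet> v i)\<close> and bound each
  product by half the sum of squares. By \<open>norm_expansion\<close> the squares of
  \<open>?y \<bullet> v i\<close> add up to the left side again, and half of it is absorbed.\<close>

lemma norm_synthesis_le: "(norm (\<Sum>i\<in>UNIV. a i *\<^sub>R v i))\<^sup>2 \<le> (\<Sum>i\<in>UNIV. (a i)\<^sup>2)"
proof -
  let ?y = "\<Sum>i\<in>UNIV. a i *\<^sub>R v i"
  have "(norm ?y)\<^sup>2 = (\<Sum>i\<in>UNIV. a i * (?y \<bullet> v i))"
    unfolding power2_norm_eq_inner by (subst inner_sum_right) simp
  also have "\<dots> \<le> (\<Sum>i\<in>UNIV. ((a i)\<^sup>2 + (?y \<bullet> v i)\<^sup>2) / 2)"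
  proof (rule sum_mono)
    show "a i * (?y \<bullet> v i) \<le> ((a i)\<^sup>2 + (?y \<bullet> v i)\<^sup>2) / 2" for i
      using sum_squares_bound[of "a i" "?y \<bullet> v i"] by simp
  qed
  also have "\<dots> = ((\<Sum>i\<in>UNIV. (a i)\<^sup>2) + (norm ?y)\<^sup>2) / 2"
    by (simp add: norm_expansion[of ?y] sum.distrib flip: sum_divide_distrib)
  finally show ?thesis
    by simp
qed

lemma sum_norm_squared: "(\<Sum>i\<in>UNIV. (norm (v i))\<^sup>2) = CARD('k)"
proof -
  have "(\<Sum>i\<in>UNIV. (norm (v i))\<^sup>2) = (\<Sum>i\<in>UNIV. \<Sum>j\<in>UNIV. v i $ j * v i $ j)"
    unfolding power2_norm_eq_inner inner_vec_def by simp
  also have "\<dots> = (\<Sum>j\<in>UNIV. (\<Sum>i\<in>UNIV. v i $ j *\<^sub>R v i) $ j)"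
    by (subst sum.swap) simp
  finally show ?thesis
    by (simp add: frame)
qed

text \<open>The boundary lies in finitely many hyperplanes; for \<open>v i = 0\<close> the
  corresponding sets are empty because \<open>r\<close> is nonzero.\<close>

lemma negligible_slab_boundary:
  assumes "0 < r"
  shows "negligible ({x. \<forall>i. \<bar>x \<bullet> v i\<bar> \<le> r} - {x. \<forall>i. \<bar>x \<bullet> v i\<bar> < r})"
proof (rule negligible_subset)
  show "negligible (\<Union>i\<in>UNIV. {x. v i \<bullet> x = r} \<union> {x. v i \<bullet> x = - r})"
    using assms by (intro negligible_Union finite_imageI finite) (auto intro!: negligible_Un negligible_hyperplane)
  show "{x. \<forall>i. \<bar>x \<bullet> v i\<bar> \<le> r} - {x. \<forall>i. \<bar>x \<bullet> v i\<bar> < r}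
      \<subseteq> (\<Union>i\<in>UNIV. {x. v i \<bullet> x = r} \<union> {x. v i \<bullet> x = - r})"
  proof
    fix x assume "x \<in> {x. \<forall>i. \<bar>x \<bullet> v i\<bar> \<le> r} - {x. \<forall>i. \<bar>x \<bullet> v i\<bar> < r}"
    then obtain i where "\<bar>x \<bullet> v i\<bar> = r"
      by (force simp: order_le_less)
    then have "v i \<bullet> x = r \<or> v i \<bullet> x = - r"
      by (auto simp: inner_commute)
    then show "x \<in> (\<Union>i\<in>UNIV. {x. v i \<bullet> x = r} \<union> {x. v i \<bullet> x = - r})"
      by blast
  qed
qed

end

theorem gaussian_brascamp_lieb_slabs:
  fixes v :: "'n::finite \<Rightarrow> real ^ 'k::{finite,wellorder}"
  assumes v: "parseval_frame v" and r: "0 < r"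
  shows "integral {x. \<forall>i. \<bar>x \<bullet> v i\<bar> \<le> r} gaussian_density
    \<le> exp (\<Sum>i\<in>UNIV. (norm (v i))\<^sup>2 * ln (normal_interval (r / norm (v i))))"
proof -
  interpret parseval_frame v by fact
  define c where "c i = (norm (v i))\<^sup>2" for i
  define z where "z i = ln (normal_interval (r / norm (v i)))" for i
  have "\<forall>i. \<exists>S S'. \<forall>s. \<bar>s\<bar> < r \<and> (c i = 0 \<longrightarrow> s = 0) \<longrightarrow>
      (S has_real_derivative S' s) (at s) \<and> 0 < S' s \<and>
      - s\<^sup>2 / 2 = c i * z i + c i * ln (S' s) - (S s)\<^sup>2 / 2"
    using scaled_normal_interval_transport[OF _ r, of "c _"] by (simp add: c_def z_def)
  then obtain S S' where S: "\<And>i s. \<bar>s\<bar> < r \<Longrightarrow> (c i = 0 \<Longrightarrow> s = 0) \<Longrightarrow>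
      (S i has_real_derivative S' i s) (at s) \<and> 0 < S' i s \<and>
      - s\<^sup>2 / 2 = c i * z i + c i * ln (S' i s) - (S i s)\<^sup>2 / 2"
    by metis
  \<comment> \<open>The transport maps are controlled only on the open slabs, so the argument runs
    on \<open>A\<close>; the boundary is null.\<close>
  define A where "A = {x. \<forall>i. \<bar>x \<bullet> v i\<bar> < r}"
  have SA: "(S i has_real_derivative S' i (x \<bullet> v i)) (at (x \<bullet> v i))"
    "0 < S' i (x \<bullet> v i)"
    "- (x \<bullet> v i)\<^sup>2 / 2 = c i * z i + c i * ln (S' i (x \<bullet> v i)) - (S i (x \<bullet> v i))\<^sup>2 / 2"
    if "x \<in> A" for x i
    using S[of "x \<bullet> v i" i] that by (auto simp: A_def c_def)
  define \<Theta> where "\<Theta> x = (\<Sum>i\<in>UNIV. S i (x \<bullet> v i) *\<^sub>R v i)" for x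
  define D where "D x h = (\<Sum>i\<in>UNIV. (S' i (x \<bullet> v i) * (h \<bullet> v i)) *\<^sub>R v i)" for x h
  have "A = (\<Inter>i\<in>UNIV. {x. \<bar>x \<bullet> v i\<bar> < r})"
    by (auto simp: A_def)
  then have "open A"
    by (auto intro!: open_INT open_Collect_less continuous_intros)
  have der: "(\<Theta> has_derivative D x) (at x)" if "x \<in> A" for x
  proof -
    have "((\<lambda>x. S i (x \<bullet> v i)) has_derivative (\<lambda>h. S' i (x \<bullet> v i) * (h \<bullet> v i))) (at x)" for i
      using SA(1)[OF that, of i] unfolding has_field_derivative_def
      by (rule has_derivative_compose[rotated]) (auto intro!: derivative_eq_intros)
    then show ?thesis
      unfolding \<Theta>_def[abs_def] D_def[abs_def] by (auto intro!: derivative_intros)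
  qed
  have inj: "inj_on \<Theta> A"
  proof (rule inj_onI, rule ccontr)
    fix x y assume xy: "x \<in> A" "y \<in> A" "\<Theta> x = \<Theta> y" "x \<noteq> y"
    \<comment> \<open>Requiring \<open>s\<close> and \<open>t\<close> to be values of
      \<open>w \<bullet> v i\<close> keeps everything between them in the domain of
      \<open>S\<close>, also in the degenerate case \<open>c i = 0\<close>.\<close>
    have less: "S i s < S i t" if "s < t" "\<exists>w\<in>A. s = w \<bullet> v i" "\<exists>w\<in>A. t = w \<bullet> v i" for i s t
    proof (rule DERIV_pos_imp_increasing[OF that(1)])
      fix u assume "s \<le> u" "u \<le> t"
      moreover have "\<bar>s\<bar> < r" "\<bar>t\<bar> < r" "c i = 0 \<Longrightarrow> s = 0 \<and> t = 0"
        using that by (auto simp: A_def c_def)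
      ultimately have "\<bar>u\<bar> < r" "c i = 0 \<Longrightarrow> u = 0"
        by auto
      then show "\<exists>d. DERIV (S i) u :> d \<and> 0 < d"
        using S by blast
    qed
    have "x \<bullet> v i < y \<bullet> v i \<Longrightarrow> S i (x \<bullet> v i) < S i (y \<bullet> v i)"
      "y \<bullet> v i < x \<bullet> v i \<Longrightarrow> S i (y \<bullet> v i) < S i (x \<bullet> v i)" for i
      using less xy(1,2) by blast+
    then have gt: "0 < (S i (x \<bullet> v i) - S i (y \<bullet> v i)) * (x \<bullet> v i - y \<bullet> v i)" if "x \<bullet> v i \<noteq> y \<bullet> v i" for i
      using that by (auto simp: zero_less_mult_iff neq_iff)
    then have ge: "0 \<le> (S i (x \<bullet> v i) - S i (y \<bullet> v i)) * (x \<bullet> v i - y \<bullet> v i)" for i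
      by (cases "x \<bullet> v i = y \<bullet> v i") (auto intro: less_imp_le)
    have "0 < (norm (x - y))\<^sup>2"
      using xy by simp
    \<comment> \<open>By Parseval, distinct points differ in some inner product. Strict monotonicity
      then makes the inner product of \<open>\<Theta> x - \<Theta> y\<close> with
      \<open>x - y\<close> positive.\<close>
    then obtain i where "x \<bullet> v i \<noteq> y \<bullet> v i"
      unfolding norm_expansion by (metis (no_types, lifting) inner_diff_left diff_self less_irrefl
          power_zero_numeral sum.neutral)
    then have "0 < (\<Sum>i\<in>UNIV. (S i (x \<bullet> v i) - S i (y \<bullet> v i)) * (x \<bullet> v i - y \<bullet> v i))"
      using ge gt by (intro sum_pos2[of _ i]) auto
    also have "\<dots> = (\<Theta> x - \<Theta> y) \<bullet> (x - y)"
      by (simp add: \<Theta>_def inner_sum_left inner_sum_right inner_diff_left inner_diff_right inner_commute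
          algebra_simps sum.distrib sum_subtractf)
    finally show False
      using xy by simp
  qed
  have pointwise: "gaussian_density x \<le> exp (\<Sum>i\<in>UNIV. c i * z i) * (\<bar>det (matrix (D x))\<bar> * gaussian_density (\<Theta> x))"
    if "x \<in> A" for x
  proof -
    \<comment> \<open>The Jacobian matrix has exactly the form treated by
      \<open>det_frame_ge\<close>, with \<open>l i = S' i (x \<bullet> v i)\<close>.\<close>
    have mat: "matrix (D x) = (\<chi> j. \<Sum>i\<in>UNIV. (S' i (x \<bullet> v i) * v i $ j) *\<^sub>R v i)"
      by (simp add: matrix_def D_def vec_eq_iff inner_axis_axis inner_axis' mult_ac)
    have "- (norm x)\<^sup>2 / 2 = (\<Sum>i\<in>UNIV. - (x \<bullet> v i)\<^sup>2 / 2)"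
      by (simp add: norm_expansion sum_negf sum_divide_distrib)
    also have "\<dots> = (\<Sum>i\<in>UNIV. c i * z i) + (\<Sum>i\<in>UNIV. c i * ln (S' i (x \<bullet> v i)))
        - (\<Sum>i\<in>UNIV. (S i (x \<bullet> v i))\<^sup>2) / 2"
      unfolding SA(3)[OF that] by (simp add: sum.distrib sum_subtractf sum_divide_distrib)
    also have "\<dots> \<le> (\<Sum>i\<in>UNIV. c i * z i) + (\<Sum>i\<in>UNIV. c i * ln (S' i (x \<bullet> v i))) + (- (norm (\<Theta> x))\<^sup>2 / 2)"
      using norm_synthesis_le[of "\<lambda>i. S i (x \<bullet> v i)"] by (simp add: \<Theta>_def)
    finally have "exp (- (norm x)\<^sup>2 / 2) \<le> exp (\<Sum>i\<in>UNIV. c i * z i)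
        * (exp (\<Sum>i\<in>UNIV. c i * ln (S' i (x \<bullet> v i))) * exp (- (norm (\<Theta> x))\<^sup>2 / 2))"
      by (simp flip: exp_add)
    also have "\<dots> \<le> exp (\<Sum>i\<in>UNIV. c i * z i)
        * (\<bar>det (matrix (D x))\<bar> * exp (- (norm (\<Theta> x))\<^sup>2 / 2))"
      using det_frame_ge[OF frame, of "\<lambda>i. S' i (x \<bullet> v i)"] SA(2)[OF that]
      by (intro mult_left_mono mult_right_mono) (auto simp: mat c_def)
    finally have "(2 * pi) powr - (real DIM((real, 'k) vec) / 2) * exp (- (norm x)\<^sup>2 / 2)
        \<le> (2 * pi) powr - (real DIM((real, 'k) vec) / 2) * (exp (\<Sum>i\<in>UNIV. c i * z i)
          * (\<bar>det (matrix (D x))\<bar> * exp (- (norm (\<Theta> x))\<^sup>2 / 2)))"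
      by (rule mult_left_mono) simp
    then show ?thesis
      unfolding gaussian_density_def by (simp only: mult_ac)
  qed
  \<comment> \<open>Invariance of domain makes the image open, hence measurable, so the density is
    integrable on it.\<close>
  have "continuous_on A \<Theta>"
    using der by (meson continuous_at_imp_continuous_on has_derivative_continuous)
  then have "open (\<Theta> ` A)"
    using \<open>open A\<close> inj by (rule invariance_of_domain)
  then have abs: "gaussian_density absolutely_integrable_on (\<Theta> ` A)"
    by (intro set_integrable_subset[OF gaussian_density_absolutely_integrable]) auto
  have meas: "A \<in> sets lebesgue"
    using \<open>open A\<close> by auto
  have derw: "(\<Theta> has_derivative D x) (at x within A)" if "x \<in> A" for x
    using der[OF that] by (rule has_derivative_at_withinI)
  note cov = integral_change_of_variables_real[OF meas derw inj abs]
  have int: "gaussian_density integrable_on A"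
    by (intro set_lebesgue_integral_eq_integral(1) set_integrable_subset[OF gaussian_density_absolutely_integrable])
       (use meas in auto)
  have "integral {x. \<forall>i. \<bar>x \<bullet> v i\<bar> \<le> r} gaussian_density = integral A gaussian_density"
    unfolding A_def
    by (rule integral_subset_negligible[symmetric]) (auto intro: less_imp_le negligible_slab_boundary[OF r])
  also have "\<dots> \<le> integral A (\<lambda>x. exp (\<Sum>i\<in>UNIV. c i * z i) * (\<bar>det (matrix (D x))\<bar> * gaussian_density (\<Theta> x)))"
    by (rule integral_le[OF int integrable_on_mult_right[OF set_lebesgue_integral_eq_integral(1)[OF cov(1)]]])
       (auto intro: pointwise)
  also have "\<dots> = exp (\<Sum>i\<in>UNIV. c i * z i) * integral (\<Theta> ` A) gaussian_density"
    by (simp add: cov(2))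
  \<comment> \<open>Enlarging the image to the whole space leaves a total Gaussian mass of
    1.\<close>
  also have "\<dots> \<le> exp (\<Sum>i\<in>UNIV. c i * z i) * integral UNIV (gaussian_density :: (real, 'k) vec \<Rightarrow> real)"
    by (intro mult_left_mono integral_subset_le[OF subset_UNIV set_lebesgue_integral_eq_integral(1)[OF abs]
          set_lebesgue_integral_eq_integral(1)[OF gaussian_density_absolutely_integrable]])
       (simp_all add: gaussian_density_nonneg)
  finally show ?thesis
    by (simp add: integral_unique[OF gaussian_density_has_integral] c_def z_def)
qed

subsection \<open>Coordinates on the subspace\<close>

text \<open>The change of variables theorem needs a well-ordered index type; \<open>'k wo\<close> is a well-ordered
  copy of the finite type \<open>'k\<close>.\<close>

typedef 'k wo = "UNIV :: 'k set" ..

instance wo :: (finite) finite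
proof
  have "finite (Abs_wo ` (UNIV :: 'a set))"
    by simp
  then show "finite (UNIV :: 'a wo set)"
    by (simp add: type_definition.Abs_image[OF type_definition_wo])
qed

instantiation wo :: (finite) wellorder
begin

definition less_eq_wo :: "'a wo \<Rightarrow> 'a wo \<Rightarrow> bool" where
  "x \<le> y \<longleftrightarrow> to_nat (Rep_wo x) \<le> to_nat (Rep_wo y)"

definition less_wo :: "'a wo \<Rightarrow> 'a wo \<Rightarrow> bool" where
  "x < y \<longleftrightarrow> to_nat (Rep_wo x) < to_nat (Rep_wo y)"

instance
proof
  show "P a" if "\<And>x. (\<And>y. y < x \<Longrightarrow> P y) \<Longrightarrow> P x" for P and a :: "'a wo"
    by (rule measure_induct_rule[where f = "\<lambda>x. to_nat (Rep_wo x)"]) (use that in \<open>auto simp: less_wo_def\<close>)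
qed (auto simp: less_eq_wo_def less_wo_def Rep_wo_inject)

end

lemma card_wo: "CARD('k wo) = CARD('k)"
  by (rule type_definition.card[OF type_definition_wo])

section \<open>Lebesgue measure and Gaussian measure in coordinates\<close>

lemma PiM_lborel_reindex:
  assumes "finite I" "bij_betw h I J"
  shows "distr (\<Pi>\<^sub>M j\<in>J. (lborel :: real measure)) (\<Pi>\<^sub>M i\<in>I. lborel) (\<lambda>f. \<lambda>i\<in>I. f (h i))
    = (\<Pi>\<^sub>M i\<in>I. lborel)" (is "?D = _")
proof (rule product_sigma_finite.PiM_eqI)
  show "product_sigma_finite (\<lambda>_. lborel :: real measure)"
    by standard
  have J: "finite J"
    using assms bij_betw_finite by blast
  have meas: "(\<lambda>f. \<lambda>i\<in>I. f (h i)) \<in> (\<Pi>\<^sub>M j\<in>J. (lborel :: real measure)) \<rightarrow>\<^sub>M (\<Pi>\<^sub>M i\<in>I. lborel)"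
    using assms by (intro measurable_restrict measurable_component_singleton) (auto dest: bij_betwE)
  fix A :: "'a \<Rightarrow> real set"
  assume A: "\<And>i. i \<in> I \<Longrightarrow> A i \<in> sets lborel"
  let ?g = "inv_into I h"
  have g: "?g j \<in> I" "h (?g j) = j" if "j \<in> J" for j
    using that assms by (auto simp: bij_betw_def inv_into_into f_inv_into_f)
  have gh: "?g (h i) = i" "h i \<in> J" if "i \<in> I" for i
    using that assms by (auto simp: bij_betw_def)
  have "(\<lambda>f. \<lambda>i\<in>I. f (h i)) -` Pi\<^sub>E I A \<inter> space (\<Pi>\<^sub>M j\<in>J. (lborel :: real measure)) = (\<Pi>\<^sub>E j\<in>J. A (?g j))"
  proof (intro set_eqI iffI)
    fix f assume f: "f \<in> (\<lambda>f. \<lambda>i\<in>I. f (h i)) -` Pi\<^sub>E I A \<inter> space (\<Pi>\<^sub>M j\<in>J. (lborel :: real measure))"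
    then have "f j \<in> A (?g j)" if "j \<in> J" for j
      using PiE_mem[of "\<lambda>i\<in>I. f (h i)" I A "?g j"] g[OF that] by simp
    with f show "f \<in> (\<Pi>\<^sub>E j\<in>J. A (?g j))"
      by (auto simp: space_PiM PiE_iff)
  next
    fix f assume f: "f \<in> (\<Pi>\<^sub>E j\<in>J. A (?g j))"
    then have "f (h i) \<in> A i" if "i \<in> I" for i
      using PiE_mem[OF f, of "h i"] gh[OF that] by simp
    with f show "f \<in> (\<lambda>f. \<lambda>i\<in>I. f (h i)) -` Pi\<^sub>E I A \<inter> space (\<Pi>\<^sub>M j\<in>J. (lborel :: real measure))"
      by (auto simp: space_PiM PiE_iff)
  qed
  then have "emeasure ?D (Pi\<^sub>E I A) = emeasure (\<Pi>\<^sub>M j\<in>J. lborel) (\<Pi>\<^sub>E j\<in>J. A (?g j))"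
    using A assms meas by (subst emeasure_distr) auto
  also have "\<dots> = (\<Prod>j\<in>J. emeasure lborel (A (?g j)))"
    using A g J by (intro product_sigma_finite.emeasure_PiM) (auto intro: product_sigma_finite.intro sigma_finite_lborel)
  also have "\<dots> = (\<Prod>i\<in>I. emeasure lborel (A i))"
    using prod.reindex_bij_betw[OF assms(2), of "\<lambda>j. emeasure lborel (A (?g j))"] gh by simp
  finally show "emeasure ?D (Pi\<^sub>E I A) = (\<Prod>i\<in>I. emeasure lborel (A i))" .
qed (use assms in auto)

text \<open>Both sides push a product of line measures forward; the bijection \<open>h\<close>
  matches the vector \<open>b j\<close> with \<open>axis j 1\<close>. This moves integrals over the
  subspace to \<open>real ^ 'k\<close>.\<close>

lemma frame_lborel_eq_distr_lborel:
  fixes b :: "'k::finite \<Rightarrow> 'a::euclidean_space"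
  assumes b: "bij_betw b UNIV B"
  shows "frame_lborel B = distr (lborel :: (real ^ 'k) measure) borel (\<lambda>x. \<Sum>j\<in>UNIV. x $ j *\<^sub>R b j)"
proof -
  define h where "h x = (axis (inv_into UNIV b x) 1 :: real ^ 'k)" for x
  have B: "finite B"
    using bij_betw_finite[OF b] by simp
  have "inj (\<lambda>j::'k. axis j (1::real))"
    by (auto intro!: injI simp: axis_eq_axis)
  then have ax: "bij_betw (\<lambda>j. axis j 1 :: real ^ 'k) UNIV Basis"
    by (auto simp: bij_betw_def Basis_vec_def)
  have h: "bij_betw h B Basis"
    using bij_betw_trans[OF bij_betw_inv_into[OF b] ax] by (simp add: h_def[abs_def] o_def)
  have hb: "h (b j) = axis j 1" for j
    using b by (simp add: h_def bij_betw_def)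
  have sum: "(\<Sum>x\<in>B. f (h x) *\<^sub>R x) = (\<Sum>j\<in>UNIV. (\<Sum>a\<in>Basis. f a *\<^sub>R a) $ j *\<^sub>R b j)" for f
  proof -
    have "(\<Sum>a\<in>Basis. f a *\<^sub>R a) $ j = f (axis j 1)" for j
      using inner_sum_left_Basis[of "axis j 1" f] by (simp add: cart_eq_inner_axis)
    then show ?thesis
      using sum.reindex_bij_betw[OF b, of "\<lambda>x. f (h x) *\<^sub>R x"] by (simp add: hb)
  qed
  have "frame_lborel B = distr (distr (\<Pi>\<^sub>M a\<in>Basis. lborel) (\<Pi>\<^sub>M x\<in>B. lborel) (\<lambda>f. \<lambda>x\<in>B. f (h x)))
      borel (\<lambda>f. \<Sum>x\<in>B. f x *\<^sub>R x)"
    by (simp add: frame_lborel_def PiM_lborel_reindex[OF B h])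
  also have "\<dots> = distr (\<Pi>\<^sub>M a\<in>Basis. lborel) borel (\<lambda>f. \<Sum>x\<in>B. f (h x) *\<^sub>R x)"
    using h by (subst distr_distr)
      (auto simp: o_def intro!: measurable_restrict measurable_component_singleton dest: bij_betwE)
  also have "\<dots> = distr (lborel :: (real ^ 'k) measure) borel (\<lambda>x. \<Sum>j\<in>UNIV. x $ j *\<^sub>R b j)"
    unfolding sum by (subst lborel_eq, subst distr_distr) (auto simp: o_def)
  finally show ?thesis .
qed

lemma scaled_cube_ball:
  assumes "0 < a"
  shows "(*\<^sub>R) a ` cube_ball = {x :: real ^ 'n. \<forall>i. \<bar>x $ i\<bar> \<le> a}"
proof (intro subset_antisym subsetI)
  fix x :: "real ^ 'n" assume x: "x \<in> {x. \<forall>i. \<bar>x $ i\<bar> \<le> a}"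
  have "x = a *\<^sub>R ((1 / a) *\<^sub>R x)" "(1 / a) *\<^sub>R x \<in> cube_ball"
    using x assms by (auto simp: cube_ball_def abs_le_iff minus_le_iff field_simps)
  then show "x \<in> (*\<^sub>R) a ` cube_ball"
    by blast
next
  fix x :: "real ^ 'n" assume "x \<in> (*\<^sub>R) a ` cube_ball"
  then obtain y where "x = a *\<^sub>R y" "\<And>i. \<bar>y $ i\<bar> \<le> 1"
    by (auto simp: cube_ball_def abs_le_iff minus_le_iff)
  then show "x \<in> {x. \<forall>i. \<bar>x $ i\<bar> \<le> a}"
    using assms by (auto simp: abs_mult intro: mult_left_le)
qed

lemma nn_integral_eq_integral_on:
  fixes f :: "'a::euclidean_space \<Rightarrow> real"
  assumes "f \<in> borel_measurable borel" "\<And>x. 0 \<le> f x" "f integrable_on A" "A \<in> sets borel"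
  shows "(\<integral>\<^sup>+x. ennreal (f x) * indicator A x \<partial>lborel) = ennreal (integral A f)"
proof -
  have "((\<lambda>x. f x * indicator A x) has_integral integral A f) UNIV"
    using assms(3) has_integral_restrict_UNIV[of A f "integral A f"]
    by (simp add: indicator_times_eq_if has_integral_integral)
  then have "(\<integral>\<^sup>+x. ennreal (f x * indicator A x) \<partial>lborel) = integral A f"
    using assms by (intro nn_integral_has_integral_lborel) auto
  then show ?thesis
    using assms(2) by (simp add: ennreal_mult ennreal_indicator)
qed

text \<open>Density and indicator both factor over \<open>Basis\<close>, so the integral is a
  product of one-dimensional ones.\<close>

lemma std_gaussian_cube:
  assumes a: "0 < a"
  shows "measure (std_gaussian :: (real ^ 'k) measure) ((*\<^sub>R) a ` cube_ball) = normal_interval a ^ CARD('k)"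
proof -
  let ?A = "{x :: real ^ 'k. \<forall>i. \<bar>x $ i\<bar> \<le> a}"
  have A [measurable]: "?A \<in> sets borel"
    by measurable
  interpret real_distribution std_normal_distribution
    by (rule real_dist_normal_dist)
  \<comment> \<open>A difference of values of the distribution function measures a half-open
    interval; the missing endpoint is a null set.\<close>
  have "(\<integral>\<^sup>+x. ennreal (std_normal_density x) * indicator {-a..a} x \<partial>lborel)
      = (\<integral>\<^sup>+x. ennreal (std_normal_density x) * indicator {-a<..a} x \<partial>lborel)"
    by (rule nn_integral_cong_AE, use AE_lborel_singleton[of "- a"] in eventually_elim) (auto simp: indicator_def)
  also have "\<dots> = emeasure std_normal_distribution {-a<..a}"
    by (simp add: emeasure_density)
  also have "\<dots> = ennreal (normal_interval a)"
    using a cdf_diff_eq[of "- a" a] by (simp add: emeasure_eq_measure normal_interval_def)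
  finally have one: "(\<integral>\<^sup>+x. ennreal (std_normal_density x) * indicator {-a..a} x \<partial>lborel) = ennreal (normal_interval a)" .
  have dens: "gaussian_density x = (\<Prod>b\<in>Basis. std_normal_density (x \<bullet> b))" for x :: "real ^ 'k"
  proof -
    have "(2 * pi) powr - (real DIM(real ^ 'k) / 2) = ((2 * pi) powr - (1 / 2)) ^ DIM(real ^ 'k)"
      by (simp add: powr_powr flip: powr_realpow)
    also have "(2 * pi) powr - (1 / 2) = 1 / sqrt (2 * pi)"
      by (simp add: powr_minus powr_half_sqrt divide_simps)
    finally have c: "(2 * pi) powr - (real DIM(real ^ 'k) / 2) = (1 / sqrt (2 * pi)) ^ DIM(real ^ 'k)" .
    have "(norm x)\<^sup>2 = (\<Sum>b\<in>Basis. (x \<bullet> b)\<^sup>2)"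
      unfolding power2_norm_eq_inner by (subst euclidean_inner) (simp add: power2_eq_square)
    then have "exp (- (norm x)\<^sup>2 / 2) = exp (\<Sum>b\<in>Basis. - (x \<bullet> b)\<^sup>2 / 2)"
      by (simp add: sum_negf sum_divide_distrib)
    then show ?thesis
      unfolding gaussian_density_def c std_normal_density_def prod.distrib
      by (simp add: exp_sum)
  qed
  have ind: "indicator ?A x = (\<Prod>b\<in>Basis. indicator {-a..a} (x \<bullet> b) :: ennreal)" for x
  proof (cases "x \<in> ?A")
    case True
    then have "(\<Prod>b\<in>Basis. indicator {-a..a} (x \<bullet> b) :: ennreal) = 1"
      by (intro prod.neutral) (auto simp: Basis_vec_def abs_le_iff minus_le_iff inner_axis)
    with True show ?thesis
      by simp
  next
    case False
    then obtain i where "\<not> \<bar>x $ i\<bar> \<le> a"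
      by auto
    then have "\<exists>b\<in>Basis. indicator {-a..a} (x \<bullet> b) = (0 :: ennreal)"
      by (intro bexI[of _ "axis i 1"]) (auto simp: inner_axis indicator_def)
    then show ?thesis
      using False by (simp add: prod_zero)
  qed
  have "emeasure std_gaussian ?A = (\<integral>\<^sup>+x. ennreal (gaussian_density x) * indicator ?A x \<partial>lborel)"
    by (simp add: std_gaussian_eq emeasure_density)
  also have "\<dots> = (\<integral>\<^sup>+x. (\<Prod>b\<in>Basis. ennreal (std_normal_density (x \<bullet> b)) * indicator {-a..a} (x \<bullet> b))
      \<partial>(lborel :: (real ^ 'k) measure))"
    unfolding dens ind by (simp add: prod.distrib prod_ennreal)
  also have "\<dots> = (\<Prod>b\<in>(Basis :: (real ^ 'k) set). \<integral>\<^sup>+x. ennreal (std_normal_density x) * indicator {-a..a} x \<partial>lborel)"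
    by (rule nn_integral_lborel_prod) auto
  also have "\<dots> = ennreal (normal_interval a ^ CARD('k))"
    unfolding one using normal_interval_pos[OF a] by (simp add: ennreal_power)
  finally show ?thesis
    using normal_interval_pos[OF a] by (simp add: measure_def scaled_cube_ball[OF a])
qed

text \<open>\<open>L\<close> maps \<open>real ^ 'k\<close> isometrically into \<open>E\<close>, and
  coordinate \<open>i\<close> of \<open>L x\<close> is \<open>x \<bullet> v i\<close>. So the cube
  pulls back to the slabs, and orthonormality of the \<open>b j\<close> is precisely the frame
  identity for the \<open>v i\<close>.\<close>

lemma subspace_gaussian_cube:
  fixes E :: "(real ^ 'n) set"
  assumes E: "subspace E" "dim E = CARD('k)" and r: "0 < r"
  obtains v :: "'n \<Rightarrow> real ^ 'k" where "parseval_frame v"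
    "measure (subspace_gaussian E) (E \<inter> (*\<^sub>R) r ` cube_ball)
      = integral {x. \<forall>i. \<bar>x \<bullet> v i\<bar> \<le> r} gaussian_density"
proof -
  obtain B where B: "orthonormal_basis_of E B"
    using orthonormal_basis_of_exists[OF E(1)] by blast
  note fin = orthonormal_basis_of_finite_card[OF B]
  obtain b where b: "bij_betw b (UNIV :: 'k set) B"
    using finite_same_card_bij[of "UNIV :: 'k set" B] fin E(2) by auto
  define v where "v i = (\<chi> j. b j $ i)" for i
  define L where "L x = (\<Sum>j\<in>UNIV. x $ j *\<^sub>R b j)" for x :: "real ^ 'k"
  have bB: "b j \<in> B" for j
    using b by (auto dest: bij_betwE)
  have "b j \<bullet> b l = (if j = l then 1 else 0)" for j l
    using B bB[of j] bB[of l] b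
    by (auto simp: orthonormal_basis_of_def pairwise_def orthogonal_def norm_eq_1 bij_betw_def inj_eq)
  then have "parseval_frame v"
    by unfold_locales (simp add: vec_eq_iff v_def axis_def inner_vec_def eq_commute)
  have norm: "(norm (L x))\<^sup>2 = (norm x)\<^sup>2" for x
  proof -
    \<comment> \<open>Reindexed over \<open>B\<close>, the sum has the shape needed for
      \<open>orthonormal_norm_sum\<close>.\<close>
    have L: "L x = (\<Sum>y\<in>B. x $ inv_into UNIV b y *\<^sub>R y)"
      unfolding L_def using sum.reindex_bij_betw[OF b, of "\<lambda>y. x $ inv_into UNIV b y *\<^sub>R y"] b
      by (simp add: bij_betw_def)
    have "(norm (L x))\<^sup>2 = (\<Sum>j\<in>UNIV. (x $ j)\<^sup>2)"
      unfolding L orthonormal_norm_sum[OF B]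
      using sum.reindex_bij_betw[OF b, of "\<lambda>y. (x $ inv_into UNIV b y)\<^sup>2"] b
      by (simp add: bij_betw_def)
    also have "\<dots> = (norm x)\<^sup>2"
      unfolding power2_norm_eq_inner inner_vec_def by (simp add: power2_eq_square)
    finally show ?thesis .
  qed
  have LE: "L x \<in> E" for x
    using B bB E(1) unfolding L_def
    by (intro subspace_sum subspace_scale) (auto simp: orthonormal_basis_of_def)
  let ?K = "{x. \<forall>i. \<bar>x \<bullet> v i\<bar> \<le> r}" and ?C = "{x :: real ^ 'n. \<forall>i. \<bar>x $ i\<bar> \<le> r}"
  have [measurable]: "L \<in> borel_measurable borel" "?C \<in> sets borel" "?K \<in> sets borel" "E \<in> sets borel"
    unfolding L_def using E(1) by (measurable, auto intro: closed_subspace)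
  have ind: "indicator (E \<inter> ?C) (L x) = (indicator ?K x :: ennreal)" for x
    using LE by (simp add: indicator_def L_def v_def inner_vec_def)
  have "closed ?K"
    by (intro closed_Collect_all closed_Collect_le continuous_intros)
  then have int: "gaussian_density integrable_on ?K"
    by (intro set_lebesgue_integral_eq_integral(1) set_integrable_subset[OF gaussian_density_absolutely_integrable]) auto
  have "emeasure (subspace_gaussian E) (E \<inter> ?C)
      = (\<integral>\<^sup>+x. ennreal ((2 * pi) powr - (real CARD('k) / 2) * exp (- (norm x)\<^sup>2 / 2)) * indicator (E \<inter> ?C) x \<partial>frame_lborel B)"
    unfolding subspace_gaussian_def subspace_lborel_eq[OF B] E(2) by (subst emeasure_density) auto
  also have "\<dots> = (\<integral>\<^sup>+x. ennreal (gaussian_density x) * indicator ?K x \<partial>lborel)"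
    unfolding frame_lborel_eq_distr_lborel[OF b] L_def[symmetric]
    by (subst nn_integral_distr) (auto simp: norm ind gaussian_density_def)
  also have "\<dots> = ennreal (integral ?K gaussian_density)"
    using int by (intro nn_integral_eq_integral_on) (auto simp: gaussian_density_nonneg)
  finally have "measure (subspace_gaussian E) (E \<inter> ?C) = integral ?K gaussian_density"
    using int by (simp add: measure_def integral_nonneg gaussian_density_nonneg)
  with \<open>parseval_frame v\<close> show thesis
    by (intro that) (auto simp: scaled_cube_ball[OF r])
qed

theorem theorem10:
  fixes E :: "(real ^ 'n) set" and r :: real
  assumes "subspace E" and "dim E = CARD('k::finite)" and "r > 0"
  shows "measure (subspace_gaussian E) (E \<inter> (*\<^sub>R) r ` cube_ball)
       \<le> measure (std_gaussian :: (real ^ 'k) measure)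
           ((*\<^sub>R) (r * sqrt (real CARD('n) / real CARD('k))) ` cube_ball)"
proof -
  let ?a = "r * sqrt (real CARD('n) / real CARD('k))"
  have a: "0 < ?a"
    using assms(3) by simp
  \<comment> \<open>Coordinates are indexed by \<open>'k wo\<close> to meet the
    \<open>wellorder\<close> requirement of the Brascamp-Lieb bound; only the cardinality enters the
    final estimate.\<close>
  have "dim E = CARD('k wo)"
    using assms(2) by (simp add: card_wo)
  then obtain v :: "'n \<Rightarrow> real ^ 'k wo" where v: "parseval_frame v"
    "measure (subspace_gaussian E) (E \<inter> (*\<^sub>R) r ` cube_ball)
      = integral {x. \<forall>i. \<bar>x \<bullet> v i\<bar> \<le> r} gaussian_density"
    using subspace_gaussian_cube[OF assms(1) _ assms(3)] by blast
  have "integral {x. \<forall>i. \<bar>x \<bullet> v i\<bar> \<le> r} gaussian_density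
      \<le> exp (\<Sum>i\<in>UNIV. (norm (v i))\<^sup>2 * ln (normal_interval (r / norm (v i))))"
    using v(1) assms(3) by (rule gaussian_brascamp_lieb_slabs)
  \<comment> \<open>The weights are the squared norms, whose sum is the dimension by
    \<open>sum_norm_squared\<close>.\<close>
  also have "\<dots> \<le> exp (CARD('k) * ln (normal_interval ?a))"
    using sum_ln_normal_interval_le[of UNIV r "\<lambda>i. (norm (v i))\<^sup>2" "CARD('k)"] assms(3)
      parseval_frame.sum_norm_squared[OF v(1)]
    by (simp add: card_wo)
  also have "\<dots> = normal_interval ?a ^ CARD('k)"
    using normal_interval_pos[OF a] by (simp add: exp_of_nat_mult)
  finally show ?thesis
    unfolding v(2) std_gaussian_cube[OF a] .
qed

end
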